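(* Let $n\ge1$. The relation $\mathbf{X}=\mathbf{I}/\mathbf{Y}$, i.e. the specification $\varphi(\mathbf{X},\mathbf{I},\mathbf{Y})$ that is true iff $\mathbf{X}\times\mathbf{Y}=\mathbf{I}$, with system inputs $(\mathbf{I},\mathbf{Y})$ and system outputs $\mathbf{X}$, and with the inputs restricted to odd numbers (i.e. $\varphi$ evaluates to $\bot$ whenever $\mathbf{I}$ or $\mathbf{Y}$ is even), is representable by a circuit of size polynomial in $n$ that is in SAUNF with respect to $\mathrm{set}(\mathbf{X})$ and some sequence of sets of leaves.
   Context: $\mathbf{X},\mathbf{Y}$ are sequences of $n$ Boolean variables and $\mathbf{I}$ a sequence of $2n$ Boolean variables, each read as an unsigned integer in binary; $\times$ denotes unsigned multiplication of $n$-bit integers (giving a $2n$-bit product). A circuit is an NNF circuit: a rooted DAG whose nodes are all descendants of the root, internal nodes labeled $\wedge$ or $\vee$ with two children, leaves labeled by literals or constants $\top,\bot$ (labels may repeat); size is the number of nodes, $\varphi_G$ the represented formula, $[\![\varphi_G]\!]$ its function. An $\ell$-leaf is a leaf labeled $\ell$; a set of leaves is literal-consistent if all carry the same literal. $G|_{L:b}$ relabels each leaf in $L$ by $b$; $G|_{\ell_1=b_1,\dots}$ relabels all $\ell_j$-leaves by $b_j$ ($\ell$, $\neg\ell$ distinct). $[\![\varphi]\!]_\sigma$ denotes substitution of an assignment $\sigma$. For a literal $\ell$ labeling a leaf of $G$ with variable $v_\ell$ and fresh $w,w'$: $\ell$ is $\wedge$-realizable in $G$ iff some assignment $\sigma$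 of all variables other than $v_\ell$ gives $[\![G|_{\ell=w,\neg\ell=w'}]\!]_\sigma=[\![w\wedge w']\!]$, else $\wedge$-unrealizable. A literal-consistent set $S$ of $\ell$-leaves, with $S'$ all $\ell$-leaves, is $\wedge$-(un)realizable in $G$ iff $\ell$ is $\wedge$-(un)realizable in $G|_{S'\setminus S:\bot}$. $G$ is in SAUNF w.r.t. $\mathrm{set}(\mathbf{X})$ and a non-empty sequence $S=(S_1,\dots,S_k)$ of leaf sets iff: the $S_j$ are pairwise disjoint; each $S_j$ is literal-consistent with a literal over $\mathbf{X}$; $S_1$ is $\wedge$-unrealizable in $G$; for $2\le j\le k$, $S_j$ is $\wedge$-unrealizable in $G|_{S_1:\top,\dots,S_{j-1}:\top}$; and $[\![\varphi_{G|_{S_1:\top,\dots,S_k:\top}}]\!]$ does not depend on $\mathbf{X}$. *)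

theory Defs
  imports "HOL-Computational_Algebra.Polynomial"
begin

datatype 'v literal = Pos 'v | Neg 'v

fun var_of :: "'v literal \<Rightarrow> 'v" where
  "var_of (Pos v) = v"
| "var_of (Neg v) = v"

fun negate :: "'v literal \<Rightarrow> 'v literal" where
  "negate (Pos v) = Neg v"
| "negate (Neg v) = Pos v"

fun lit_true :: "('v \<Rightarrow> bool) \<Rightarrow> 'v literal \<Rightarrow> bool" where
  "lit_true \<tau> (Pos v) = \<tau> v"
| "lit_true \<tau> (Neg v) = (\<not> \<tau> v)"

datatype 'v label = And | Or | Lit "'v literal" | Const bool

record ('a, 'v) circuit =
  nodes :: "'a set"
  edges :: "('a \<times> 'a) set"
  root :: 'a
  label :: "'a \<Rightarrow> 'v label"

definition children :: "('a, 'v) circuit \<Rightarrow> 'a \<Rightarrow> 'a set" where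
  "children G v = {u. (v, u) \<in> edges G}"

definition nnf_circuit :: "('a, 'v) circuit \<Rightarrow> bool" where
  "nnf_circuit G \<longleftrightarrow>
     finite (nodes G) \<and> edges G \<subseteq> nodes G \<times> nodes G \<and> acyclic (edges G) \<and>
     root G \<in> nodes G \<and> (\<forall>v\<in>nodes G. (root G, v) \<in> (edges G)\<^sup>*) \<and>
     (\<forall>v\<in>nodes G. if label G v \<in> {And, Or} then card (children G v) = 2
                  else children G v = {})"

definition circuit_size :: "('a, 'v) circuit \<Rightarrow> nat" where
  "circuit_size G = card (nodes G)"

definition lit_leaves :: "('a, 'v) circuit \<Rightarrow> 'v literal \<Rightarrow> 'a set" where
  "lit_leaves G l = {v \<in> nodes G. label G v = Lit l}"

definition circuit_vars :: "('a, 'v) circuit \<Rightarrow> 'v set" where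
  "circuit_vars G = {var_of l | l. lit_leaves G l \<noteq> {}}"

(* The truth value of the formula rooted at a node. There are no negation gates, so a least
   fixed point is available; on an acyclic graph it is the only solution of the gate equations. *)
inductive holds :: "('a, 'v) circuit \<Rightarrow> ('v \<Rightarrow> bool) \<Rightarrow> 'a \<Rightarrow> bool" for G \<tau> where
  holds_lit: "label G v = Lit l \<Longrightarrow> lit_true \<tau> l \<Longrightarrow> holds G \<tau> v"
| holds_const: "label G v = Const True \<Longrightarrow> holds G \<tau> v"
| holds_and: "label G v = And \<Longrightarrow> (\<And>u. u \<in> children G v \<Longrightarrow> holds G \<tau> u) \<Longrightarrow> holds G \<tau> v"
| holds_or: "label G v = Or \<Longrightarrow> u \<in> children G v \<Longrightarrow> holds G \<tau> u \<Longrightarrow> holds G \<tau> v"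

definition sem :: "('a, 'v) circuit \<Rightarrow> ('v \<Rightarrow> bool) \<Rightarrow> bool" where
  "sem G \<tau> = holds G \<tau> (root G)"

definition subst_assignment ::
    "(('v \<Rightarrow> bool) \<Rightarrow> bool) \<Rightarrow> ('v \<rightharpoonup> bool) \<Rightarrow> ('v \<Rightarrow> bool) \<Rightarrow> bool" where
  "subst_assignment f \<sigma> = (\<lambda>\<tau>. f (\<lambda>v. case \<sigma> v of None \<Rightarrow> \<tau> v | Some b \<Rightarrow> b))"

definition independent_of :: "(('v \<Rightarrow> bool) \<Rightarrow> bool) \<Rightarrow> 'v set \<Rightarrow> bool" where
  "independent_of f V \<longleftrightarrow> (\<forall>\<tau> \<tau>'. (\<forall>v. v \<notin> V \<longrightarrow> \<tau> v = \<tau>' v) \<longrightarrow> f \<tau> = f \<tau>')"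

definition relabel :: "('a, 'v) circuit \<Rightarrow> 'a set \<Rightarrow> bool \<Rightarrow> ('a, 'v) circuit" where
  "relabel G L b = G\<lparr>label := (\<lambda>v. if v \<in> L then Const b else label G v)\<rparr>"

(* The two fresh variables are adjoined to the variable type, which makes freshness automatic. *)
datatype 'v with_fresh = Old 'v | Fresh_w | Fresh_w'

definition split_literal ::
    "('a, 'v) circuit \<Rightarrow> 'v literal \<Rightarrow> ('a, 'v with_fresh) circuit" where
  "split_literal G l =
     \<lparr>nodes = nodes G, edges = edges G, root = root G,
      label = (\<lambda>v. if label G v = Lit l then Lit (Pos Fresh_w)
                   else if label G v = Lit (negate l) then Lit (Pos Fresh_w')
                   else map_label Old (label G v))\<rparr>"

definition and_realizable :: "('a, 'v) circuit \<Rightarrow> 'v literal \<Rightarrow> bool" where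
  "and_realizable G l \<longleftrightarrow>
     (\<exists>\<sigma>. dom \<sigma> = Old ` (UNIV - {var_of l}) \<and>
          subst_assignment (sem (split_literal G l)) \<sigma> = (\<lambda>\<tau>. \<tau> Fresh_w \<and> \<tau> Fresh_w'))"

(* Meant for a non-empty set L of leaves labelled l. *)
definition and_realizable_set :: "('a, 'v) circuit \<Rightarrow> 'v literal \<Rightarrow> 'a set \<Rightarrow> bool" where
  "and_realizable_set G l L \<longleftrightarrow> and_realizable (relabel G (lit_leaves G l - L) False) l"

(* As the sets are pairwise disjoint, relabelling their union is the same as relabelling them
   one after the other. Non-emptiness of each set determines its literal l uniquely. *)
definition SAUNF :: "('a, 'v) circuit \<Rightarrow> 'v set \<Rightarrow> 'a set list \<Rightarrow> bool" where
  "SAUNF G V S \<longleftrightarrow>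
     S \<noteq> [] \<and>
     (\<forall>i<length S. \<forall>j<length S. i \<noteq> j \<longrightarrow> S ! i \<inter> S ! j = {}) \<and>
     (\<forall>j<length S. S ! j \<noteq> {} \<and>
        (\<exists>l. var_of l \<in> V \<and> S ! j \<subseteq> lit_leaves G l \<and>
             \<not> and_realizable_set (relabel G (\<Union>i<j. S ! i) True) l (S ! j))) \<and>
     independent_of (sem (relabel G (\<Union>i<length S. S ! i) True)) V"

datatype div_var = VX nat | VI nat | VY nat

(* Unsigned value of an m-bit word, bit 0 being the least significant. *)
definition unsigned_val :: "nat \<Rightarrow> (nat \<Rightarrow> bool) \<Rightarrow> nat" where
  "unsigned_val m b = (\<Sum>i<m. of_bool (b i) * 2 ^ i)"

(* The product of two n-bit numbers fits into 2n bits, so no reduction is needed. *)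
definition odd_division_spec :: "nat \<Rightarrow> (div_var \<Rightarrow> bool) \<Rightarrow> bool" where
  "odd_division_spec n \<tau> \<longleftrightarrow>
     (let x = unsigned_val n (\<lambda>i. \<tau> (VX i));
          y = unsigned_val n (\<lambda>i. \<tau> (VY i));
          z = unsigned_val (2 * n) (\<lambda>i. \<tau> (VI i))
      in odd z \<and> odd y \<and> x * y = z)"

end

theory Submission
  imports Defs "HOL-Library.Countable"
begin

text \<open>For odd \<open>Y\<close>, the quotient bits are functions of \<open>I\<close> and \<open>Y\<close> alone, computed from the least
  significant bit upwards: \<open>q j\<close> is the sum modulo 2 of the \<open>j\<close>-th bits of \<open>I\<close> and of the product
  of \<open>Y\<close> with the number formed by the earlier quotient bits. Hence the relation is the conjunction
  of the equivalences \<open>x j \<longleftrightarrow> q j\<close> and of a condition on \<open>I\<close> and \<open>Y\<close>, namely that they are odd and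
  that the division is exact. If each literal over \<open>X\<close> labels a single leaf, then the leaves of
  \<open>x j\<close> and \<open>\<not> x j\<close> are guarded by \<open>q j\<close> and \<open>\<not> q j\<close>, so the singletons of these leaves, in any
  order, witness SAUNF. The nodes of the circuit are the distinct subformulas of an explicit
  formula, and there are quadratically many of them.\<close>

section \<open>Formulas as circuits with maximal sharing\<close>

datatype 'v nnf = Leaf "'v literal" | Cst bool | Conj "'v nnf" "'v nnf" | Disj "'v nnf" "'v nnf"

instance literal :: (countable) countable by countable_datatype
instance nnf :: (countable) countable by countable_datatype
instance div_var :: countable by countable_datatype

lemma negate_negate [simp]: "negate (negate l) = l"
  by (cases l) auto

lemma var_of_negate [simp]: "var_of (negate l) = var_of l"
  by (cases l) auto

primrec sub :: "'v nnf \<Rightarrow> 'v nnf set" where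
  "sub (Leaf l) = {Leaf l}"
| "sub (Cst b) = {Cst b}"
| "sub (Conj f g) = insert (Conj f g) (sub f \<union> sub g)"
| "sub (Disj f g) = insert (Disj f g) (sub f \<union> sub g)"

primrec kids :: "'v nnf \<Rightarrow> 'v nnf set" where
  "kids (Leaf l) = {}"
| "kids (Cst b) = {}"
| "kids (Conj f g) = {f, g}"
| "kids (Disj f g) = {f, g}"

primrec vars :: "'v nnf \<Rightarrow> 'v set" where
  "vars (Leaf l) = {var_of l}"
| "vars (Cst b) = {}"
| "vars (Conj f g) = vars f \<union> vars g"
| "vars (Disj f g) = vars f \<union> vars g"

text \<open>Under sharing, a gate with two equal arguments would have a single child, while circuits
  demand two.\<close>

primrec reduced :: "'v nnf \<Rightarrow> bool" where
  "reduced (Leaf l) = True"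
| "reduced (Cst b) = True"
| "reduced (Conj f g) = (f \<noteq> g \<and> reduced f \<and> reduced g)"
| "reduced (Disj f g) = (f \<noteq> g \<and> reduced f \<and> reduced g)"

text \<open>The two literals of a variable are valued independently, as relabelling leaves demands.\<close>

primrec ev :: "('v literal \<Rightarrow> bool) \<Rightarrow> 'v nnf \<Rightarrow> bool" where
  "ev \<rho> (Leaf l) = \<rho> l"
| "ev \<rho> (Cst b) = b"
| "ev \<rho> (Conj f g) = (ev \<rho> f \<and> ev \<rho> g)"
| "ev \<rho> (Disj f g) = (ev \<rho> f \<or> ev \<rho> g)"

text \<open>There are no negation gates, so complements are formed by De Morgan duality. This is an
  involution on the syntax and pairs each gate with one dual gate.\<close>

primrec neg :: "'v nnf \<Rightarrow> 'v nnf" where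
  "neg (Leaf l) = Leaf (negate l)"
| "neg (Cst b) = Cst (\<not> b)"
| "neg (Conj f g) = Disj (neg f) (neg g)"
| "neg (Disj f g) = Conj (neg f) (neg g)"

lemma neg_neg [simp]: "neg (neg f) = f"
  by (induction f) auto

lemma neg_eq_iff [simp]: "neg f = neg g \<longleftrightarrow> f = g"
  by (metis neg_neg)

lemma sub_refl [simp]: "f \<in> sub f"
  by (cases f) auto

lemma finite_sub [simp]: "finite (sub f)"
  by (induction f) auto

lemma kids_sub: "f \<in> sub g \<Longrightarrow> kids f \<subseteq> sub g"
  by (induction g) auto

lemma size_kids: "g \<in> kids f \<Longrightarrow> size g < size f"
  by (cases f) auto

lemma reduced_sub: "reduced g \<Longrightarrow> f \<in> sub g \<Longrightarrow> reduced f"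
  by (induction g) auto

lemma sub_neg: "sub (neg f) = neg ` sub f"
  by (induction f) auto

lemma vars_neg [simp]: "vars (neg f) = vars f"
  by (induction f) auto

lemma reduced_neg [simp]: "reduced (neg f) = reduced f"
  by (induction f) auto

lemma Leaf_in_sub_vars: "Leaf l \<in> sub f \<Longrightarrow> var_of l \<in> vars f"
  by (induction f) auto

lemma ev_cong: "(\<And>l. var_of l \<in> vars f \<Longrightarrow> \<rho> l = \<rho>' l) \<Longrightarrow> ev \<rho> f = ev \<rho>' f"
  by (induction f) auto

lemma ev_neg: "(\<And>l. var_of l \<in> vars f \<Longrightarrow> \<rho> (negate l) = (\<not> \<rho> l)) \<Longrightarrow> ev \<rho> (neg f) = (\<not> ev \<rho> f)"
  by (induction f) auto

text \<open>The parameter \<open>\<Lambda>\<close> covers the original leaves, leaves made constant,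
  and leaves split into fresh variables; the last case needs the second variable type.\<close>

definition nnf_label :: "('v literal \<Rightarrow> 'w label) \<Rightarrow> 'v nnf \<Rightarrow> 'w label" where
  "nnf_label \<Lambda> f = (case f of Leaf l \<Rightarrow> \<Lambda> l | Cst b \<Rightarrow> Const b | Conj _ _ \<Rightarrow> And | Disj _ _ \<Rightarrow> Or)"

text \<open>Nodes are codes of subformulas, so equal subformulas share a node. Size counts distinct
  subformulas, and each literal labels at most one leaf.\<close>

definition circ :: "'v::countable nnf \<Rightarrow> (nat, 'v) circuit" where
  "circ \<phi> = \<lparr>nodes = to_nat ` sub \<phi>,
     edges = {(to_nat f, to_nat g) |f g. f \<in> sub \<phi> \<and> g \<in> kids f},
     root = to_nat \<phi>, label = (\<lambda>v. nnf_label Lit (from_nat v :: 'v nnf))\<rparr>"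

lemma children_circ:
  assumes "edges H = edges (circ \<phi>)" "f \<in> sub \<phi>"
  shows "children H (to_nat f) = to_nat ` kids f"
  using assms by (auto simp: children_def circ_def)

lemma lit_leaves_circ: "lit_leaves (circ \<phi>) l = (if Leaf l \<in> sub \<phi> then {to_nat (Leaf l)} else {})"
proof -
  have "nnf_label Lit f = Lit l \<longleftrightarrow> f = Leaf l" for f by (cases f) (auto simp: nnf_label_def)
  then have "lit_leaves (circ \<phi>) l = to_nat ` {f \<in> sub \<phi>. f = Leaf l}"
    unfolding lit_leaves_def circ_def by fastforce
  then show ?thesis by auto
qed

lemma circuit_size_circ: "circuit_size (circ \<phi>) = card (sub \<phi>)"
  by (simp add: circuit_size_def circ_def card_image)

lemma circuit_vars_circ: "circuit_vars (circ \<phi>) \<subseteq> vars \<phi>"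
  by (auto simp: circuit_vars_def lit_leaves_circ Leaf_in_sub_vars split: if_splits)

lemma reachable_circ:
  "\<psi> \<in> sub \<phi> \<Longrightarrow> f \<in> sub \<psi> \<Longrightarrow> (to_nat \<psi>, to_nat f) \<in> (edges (circ \<phi>))\<^sup>*"
proof (induction \<psi>)
  case (Conj a b)
  have "a \<in> sub \<phi>" "b \<in> sub \<phi>" using kids_sub[OF Conj.prems(1)] by auto
  moreover have "(to_nat (Conj a b), to_nat a) \<in> edges (circ \<phi>)"
    "(to_nat (Conj a b), to_nat b) \<in> edges (circ \<phi>)"
    using Conj.prems(1) by (auto simp: circ_def)
  ultimately show ?case using Conj by (auto intro: converse_rtrancl_into_rtrancl)
next
  case (Disj a b)
  have "a \<in> sub \<phi>" "b \<in> sub \<phi>" using kids_sub[OF Disj.prems(1)] by auto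
  moreover have "(to_nat (Disj a b), to_nat a) \<in> edges (circ \<phi>)"
    "(to_nat (Disj a b), to_nat b) \<in> edges (circ \<phi>)"
    using Disj.prems(1) by (auto simp: circ_def)
  ultimately show ?case using Disj by (auto intro: converse_rtrancl_into_rtrancl)
qed auto

lemma nnf_circuit_circ:
  fixes \<phi> :: "'v::countable nnf"
  assumes "reduced \<phi>"
  shows "nnf_circuit (circ \<phi>)"
proof -
  \<comment> \<open>Edges lead to strictly smaller formulas, so the converse relation is
    well-founded and therefore acyclic.\<close>
  have "(edges (circ \<phi>))\<inverse> \<subseteq> measure (\<lambda>v. size (from_nat v :: 'v nnf))"
    by (auto simp: circ_def size_kids)
  then have "acyclic ((edges (circ \<phi>))\<inverse>)"
    by (metis wf_measure wf_subset wf_acyclic)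
  then have acyc: "acyclic (edges (circ \<phi>))" by simp
  have gates: "if label (circ \<phi>) v \<in> {And, Or} then card (children (circ \<phi>) v) = 2
      else children (circ \<phi>) v = {}" if v: "v \<in> nodes (circ \<phi>)" for v
  proof -
    obtain f where f: "f \<in> sub \<phi>" "v = to_nat f" using v by (auto simp: circ_def)
    \<comment> \<open>\<open>to_nat\<close> is injective and \<open>reduced\<close> makes the two
      arguments of a gate distinct, which gives exactly two children.\<close>
    have "card (to_nat ` kids f) = card (kids f)" by (simp add: card_image)
    then show ?thesis
      using reduced_sub[OF assms f(1)] children_circ[OF refl f(1)] f(2)
      by (cases f) (auto simp: circ_def nnf_label_def)
  qed
  have "edges (circ \<phi>) \<subseteq> nodes (circ \<phi>) \<times> nodes (circ \<phi>)"
    using kids_sub by (fastforce simp: circ_def)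
  moreover have "\<forall>v\<in>nodes (circ \<phi>). (root (circ \<phi>), v) \<in> (edges (circ \<phi>))\<^sup>*"
    using reachable_circ[OF sub_refl] by (auto simp: circ_def)
  moreover have "finite (nodes (circ \<phi>))" "root (circ \<phi>) \<in> nodes (circ \<phi>)"
    by (auto simp: circ_def)
  ultimately show ?thesis
    unfolding nnf_circuit_def using acyc gates by blast
qed

section \<open>Semantics of circuits with relabelled or split leaves\<close>

fun leaf_value :: "('w \<Rightarrow> bool) \<Rightarrow> 'w label \<Rightarrow> bool" where
  "leaf_value \<tau> (Lit l) = lit_true \<tau> l"
| "leaf_value \<tau> (Const b) = b"
| "leaf_value \<tau> _ = False"

text \<open>Relabelling and splitting change leaf labels only, so one structural induction evaluates
  all these circuits. The assumption \<open>leaf\<close> prevents a leaf from turning into a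
  gate.\<close>

lemma holds_relabelled_circ:
  fixes \<phi> :: "'v::countable nnf" and H :: "(nat, 'w) circuit"
  assumes H: "edges H = edges (circ \<phi>)"
    and lab: "\<And>f :: 'v nnf. label H (to_nat f) = nnf_label \<Lambda> f"
    and leaf: "\<And>l. \<Lambda> l \<notin> {And, Or}"
  shows "f \<in> sub \<phi> \<Longrightarrow> holds H \<tau> (to_nat f) = ev (\<lambda>l. leaf_value \<tau> (\<Lambda> l)) f"
proof (induction f)
  case (Leaf l)
  show ?case
    using leaf[of l] lab[of "Leaf l"]
    by (cases "\<Lambda> l") (auto simp: nnf_label_def elim: holds.cases intro: holds.intros)
next
  case (Cst b)
  show ?case
    using lab[of "Cst b"] by (auto simp: nnf_label_def elim: holds.cases intro: holds.intros)
next
  case (Conj a b)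
  have IH: "holds H \<tau> (to_nat a) = ev (\<lambda>l. leaf_value \<tau> (\<Lambda> l)) a"
    "holds H \<tau> (to_nat b) = ev (\<lambda>l. leaf_value \<tau> (\<Lambda> l)) b"
    using Conj kids_sub[OF Conj.prems] by auto
  have ch: "children H (to_nat (Conj a b)) = {to_nat a, to_nat b}"
    using children_circ[OF H Conj.prems] by simp
  show ?case
    unfolding ev.simps IH[symmetric] holds.simps[of H \<tau> "to_nat (Conj a b)"]
    by (auto simp: lab nnf_label_def ch)
next
  case (Disj a b)
  have IH: "holds H \<tau> (to_nat a) = ev (\<lambda>l. leaf_value \<tau> (\<Lambda> l)) a"
    "holds H \<tau> (to_nat b) = ev (\<lambda>l. leaf_value \<tau> (\<Lambda> l)) b"
    using Disj kids_sub[OF Disj.prems] by auto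
  have ch: "children H (to_nat (Disj a b)) = {to_nat a, to_nat b}"
    using children_circ[OF H Disj.prems] by simp
  show ?case
    unfolding ev.simps IH[symmetric] holds.simps[of H \<tau> "to_nat (Disj a b)"]
    by (auto simp: lab nnf_label_def ch)
qed

abbreviation sat :: "('v \<Rightarrow> bool) \<Rightarrow> 'v nnf \<Rightarrow> bool" where
  "sat \<tau> \<equiv> ev (lit_true \<tau>)"

lemma sem_circ: "sem (circ \<phi>) \<tau> = sat \<tau> \<phi>"
  using holds_relabelled_circ[of "circ \<phi>" \<phi> Lit \<phi> \<tau>] by (simp add: sem_def circ_def)

lemma sem_relabel_circ:
  "sem (relabel (circ \<phi>) ((\<lambda>l. to_nat (Leaf l)) ` T) True) \<tau> = ev (\<lambda>l. l \<in> T \<or> lit_true \<tau> l) \<phi>"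
proof -
  have "holds (relabel (circ \<phi>) ((\<lambda>l. to_nat (Leaf l)) ` T) True) \<tau> (to_nat \<phi>)
      = ev (\<lambda>l. leaf_value \<tau> (if l \<in> T then Const True else Lit l)) \<phi>"
    by (rule holds_relabelled_circ)
      (auto simp: relabel_def circ_def nnf_label_def split: nnf.splits)
  also have "\<dots> = ev (\<lambda>l. l \<in> T \<or> lit_true \<tau> l) \<phi>"
    by (rule ev_cong) auto
  finally show ?thesis by (simp add: sem_def relabel_def circ_def)
qed

text \<open>Relabelling precedes splitting, so membership in \<open>T\<close> is tested first: a
  leaf already made constant carries no literal to replace.\<close>

lemma sem_split_relabel_circ:
  "sem (split_literal (relabel (circ \<phi>) ((\<lambda>l. to_nat (Leaf l)) ` T) True) l) \<tau> =
   ev (\<lambda>l'. l' \<in> T \<or> (if l' = l then \<tau> Fresh_w else if l' = negate l then \<tau> Fresh_w'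
                        else lit_true (\<tau> \<circ> Old) l')) \<phi>"
proof -
  have "holds (split_literal (relabel (circ \<phi>) ((\<lambda>l. to_nat (Leaf l)) ` T) True) l) \<tau> (to_nat \<phi>)
      = ev (\<lambda>l'. leaf_value \<tau> (if l' \<in> T then Const True else if l' = l then Lit (Pos Fresh_w)
            else if l' = negate l then Lit (Pos Fresh_w') else Lit (map_literal Old l'))) \<phi>"
    by (rule holds_relabelled_circ)
      (auto simp: split_literal_def relabel_def circ_def nnf_label_def split: nnf.splits)
  also have "lit_true \<tau> (map_literal Old l') = lit_true (\<tau> \<circ> Old) l'" for l'
    by (cases l') auto
  then have "ev (\<lambda>l'. leaf_value \<tau> (if l' \<in> T then Const True else if l' = l then Lit (Pos Fresh_w)
            else if l' = negate l then Lit (Pos Fresh_w') else Lit (map_literal Old l'))) \<phi>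
     = ev (\<lambda>l'. l' \<in> T \<or> (if l' = l then \<tau> Fresh_w else if l' = negate l then \<tau> Fresh_w'
                        else lit_true (\<tau> \<circ> Old) l')) \<phi>"
    by (intro ev_cong) auto
  finally show ?thesis by (simp add: sem_def split_literal_def relabel_def circ_def)
qed

section \<open>Gates\<close>

text \<open>Merging equal arguments keeps formulas reduced, as a gate needs two distinct children.\<close>

definition mk_and :: "'v nnf \<Rightarrow> 'v nnf \<Rightarrow> 'v nnf" where
  "mk_and f g = (if f = g then f else Conj f g)"

definition mk_or :: "'v nnf \<Rightarrow> 'v nnf \<Rightarrow> 'v nnf" where
  "mk_or f g = (if f = g then f else Disj f g)"

text \<open>When \<open>f\<close> is a leaf, this form guards its literal by \<open>g\<close> and
  the complementary literal by \<open>neg g\<close>.\<close>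

definition mk_iff :: "'v nnf \<Rightarrow> 'v nnf \<Rightarrow> 'v nnf" where
  "mk_iff f g = mk_or (mk_and f g) (mk_and (neg f) (neg g))"

abbreviation mk_xor :: "'v nnf \<Rightarrow> 'v nnf \<Rightarrow> 'v nnf" where
  "mk_xor f g \<equiv> mk_iff (neg f) g"

primrec conjs :: "'v nnf list \<Rightarrow> 'v nnf" where
  "conjs [] = Cst True"
| "conjs (f # fs) = mk_and f (conjs fs)"

lemma ev_mk_and [simp]: "ev \<rho> (mk_and f g) = (ev \<rho> f \<and> ev \<rho> g)"
  by (simp add: mk_and_def)

lemma ev_mk_or [simp]: "ev \<rho> (mk_or f g) = (ev \<rho> f \<or> ev \<rho> g)"
  by (simp add: mk_or_def)

lemma ev_conjs [simp]: "ev \<rho> (conjs fs) = (\<forall>f\<in>set fs. ev \<rho> f)"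
  by (induction fs) auto

lemma sat_neg [simp]: "sat \<tau> (neg f) = (\<not> sat \<tau> f)"
proof (rule ev_neg)
  show "lit_true \<tau> (negate l) = (\<not> lit_true \<tau> l)" for l by (cases l) auto
qed

lemma sat_mk_iff [simp]: "sat \<tau> (mk_iff f g) = (sat \<tau> f = sat \<tau> g)"
  by (auto simp: mk_iff_def)

lemma reduced_mk [simp]:
  "reduced f \<Longrightarrow> reduced g \<Longrightarrow> reduced (mk_and f g)"
  "reduced f \<Longrightarrow> reduced g \<Longrightarrow> reduced (mk_or f g)"
  "reduced f \<Longrightarrow> reduced g \<Longrightarrow> reduced (mk_iff f g)"
  by (auto simp: mk_and_def mk_or_def mk_iff_def)

lemma reduced_conjs: "(\<And>f. f \<in> set fs \<Longrightarrow> reduced f) \<Longrightarrow> reduced (conjs fs)"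
  by (induction fs) auto

lemma vars_mk [simp]:
  "vars (mk_and f g) = vars f \<union> vars g"
  "vars (mk_or f g) = vars f \<union> vars g"
  "vars (mk_iff f g) = vars f \<union> vars g"
  by (auto simp: mk_and_def mk_or_def mk_iff_def)

lemma vars_conjs [simp]: "vars (conjs fs) = (\<Union>f\<in>set fs. vars f)"
  by (induction fs) auto

lemma sub_mk_and: "sub f \<union> sub g \<subseteq> sub (mk_and f g)"
  by (auto simp: mk_and_def)

lemma sub_mk_or: "sub f \<union> sub g \<subseteq> sub (mk_or f g)"
  by (auto simp: mk_or_def)

lemma sub_conjs: "f \<in> set fs \<Longrightarrow> sub f \<subseteq> sub (conjs fs)"
  using sub_mk_and by (induction fs) fastforce+

section \<open>Specifications with explicit Skolem functions\<close>

text \<open>Here \<open>\<chi>\<close> is meant as the condition on the system inputs and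
  \<open>h x\<close> as a Skolem function for the output \<open>x\<close>.\<close>

definition skolem_form :: "'v nnf \<Rightarrow> ('v \<Rightarrow> 'v nnf) \<Rightarrow> 'v list \<Rightarrow> 'v nnf" where
  "skolem_form \<chi> h xs = mk_and \<chi> (conjs (map (\<lambda>x. mk_iff (Leaf (Pos x)) (h x)) xs))"

text \<open>\<open>neg (h x)\<close> stays explicit because \<open>\<rho>\<close> need not give
  complementary literals opposite values.\<close>

lemma ev_skolem_form:
  "ev \<rho> (skolem_form \<chi> h xs) \<longleftrightarrow> ev \<rho> \<chi> \<and>
     (\<forall>x\<in>set xs. \<rho> (Pos x) \<and> ev \<rho> (h x) \<or> \<rho> (Neg x) \<and> ev \<rho> (neg (h x)))"
  by (simp add: skolem_form_def mk_iff_def)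

text \<open>Merging equal arguments never discards a subformula, so both literals of every output
  survive. This makes the singletons of the SAUNF sequence sets of actual leaves.\<close>

lemma Leaf_in_skolem_form:
  assumes "var_of l \<in> set xs"
  shows "Leaf l \<in> sub (skolem_form \<chi> h xs)"
proof -
  let ?g = "mk_iff (Leaf (Pos (var_of l))) (h (var_of l))"
  have "Leaf l \<in> sub ?g"
    by (cases l) (auto simp: mk_iff_def intro!: subsetD[OF sub_mk_or] subsetD[OF sub_mk_and])
  moreover have "sub ?g \<subseteq> sub (skolem_form \<chi> h xs)"
    using sub_conjs[of ?g "map (\<lambda>x. mk_iff (Leaf (Pos x)) (h x)) xs"] assms
      sub_mk_and[of \<chi>] by (fastforce simp: skolem_form_def)
  ultimately show ?thesis by blast
qed

text \<open>The conjunct of a variable \<open>x\<close> has the form \<open>w \<and> q \<or> w' \<and> \<not> q\<close> with \<open>q\<close> free of the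
  system outputs. Whatever the value of \<open>q\<close>, one of \<open>w\<close>, \<open>w'\<close> alone makes it true; this is
  unaffected by having set further output literals to true.\<close>

lemma skolem_form_unrealizable:
  fixes \<chi> :: "'v::countable nnf"
  assumes \<chi>: "vars \<chi> \<inter> set xs = {}" and h: "\<And>x. x \<in> set xs \<Longrightarrow> vars (h x) \<inter> set xs = {}"
    and l: "var_of l \<in> set xs" and T: "var_of ` T \<subseteq> set xs"
  shows "\<not> and_realizable (relabel (circ (skolem_form \<chi> h xs)) ((\<lambda>l. to_nat (Leaf l)) ` T) True) l"
proof
  let ?\<phi> = "skolem_form \<chi> h xs"
  assume "and_realizable (relabel (circ ?\<phi>) ((\<lambda>l. to_nat (Leaf l)) ` T) True) l"
  then obtain \<sigma> where dom: "dom \<sigma> = Old ` (UNIV - {var_of l})"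
    and eq: "subst_assignment (sem (split_literal (relabel (circ ?\<phi>) ((\<lambda>l. to_nat (Leaf l)) ` T) True) l)) \<sigma>
        = (\<lambda>\<tau>. \<tau> Fresh_w \<and> \<tau> Fresh_w')"
    unfolding and_realizable_def by blast
  \<comment> \<open>\<open>s\<close> completes \<open>\<sigma>\<close> by \<open>False\<close> at
    \<open>var_of l\<close>, whose two literals take their values from \<open>w\<close> and
    \<open>w'\<close> in \<open>\<rho>\<close>.\<close>
  define s where "s = (\<lambda>v. case \<sigma> (Old v) of None \<Rightarrow> False | Some b \<Rightarrow> b)"
  define \<rho> where "\<rho> w w' = (\<lambda>l'. l' \<in> T \<or> (if l' = l then w else if l' = negate l then w'
      else lit_true s l'))" for w w'
  have key: "ev (\<rho> w w') ?\<phi> \<longleftrightarrow> w \<and> w'" for w w'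
  proof -
    let ?\<tau> = "\<lambda>v. case v of Fresh_w \<Rightarrow> w | Fresh_w' \<Rightarrow> w' | Old _ \<Rightarrow> False"
    have fresh: "\<sigma> Fresh_w = None" "\<sigma> Fresh_w' = None" using dom by (auto simp: dom_def)
    have "(w \<and> w') = subst_assignment
        (sem (split_literal (relabel (circ ?\<phi>) ((\<lambda>l. to_nat (Leaf l)) ` T) True) l)) \<sigma> ?\<tau>"
      unfolding eq by simp
    also have "\<dots> = ev (\<rho> w w') ?\<phi>"
      by (simp add: subst_assignment_def sem_split_relabel_circ fresh \<rho>_def s_def comp_def
          cong: option.case_cong)
    finally show ?thesis by simp
  qed
  \<comment> \<open>Formulas over the inputs see neither \<open>w\<close>, \<open>w'\<close> nor
    \<open>T\<close>, so the guards have fixed values.\<close>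
  have free: "ev (\<rho> w w') f = sat s f" if "vars f \<inter> set xs = {}" for w w' f
  proof (rule ev_cong)
    fix l' assume "var_of l' \<in> vars f"
    then have "var_of l' \<notin> set xs" using that by auto
    then show "\<rho> w w' l' = lit_true s l'" using l T by (auto simp: \<rho>_def)
  qed
  have ev: "ev (\<rho> w w') ?\<phi> \<longleftrightarrow> sat s \<chi> \<and>
     (\<forall>x\<in>set xs. if sat s (h x) then \<rho> w w' (Pos x) else \<rho> w w' (Neg x))" for w w'
    unfolding ev_skolem_form using \<chi> h by (auto simp: free)
  have other: "\<rho> w w' l' = \<rho> True True l'" if "var_of l' \<noteq> var_of l" for w w' l'
    using that by (auto simp: \<rho>_def)
  \<comment> \<open>The assumed equality with \<open>w \<and> w'\<close> makes the formula true
    here, which settles \<open>\<chi>\<close> and the conjuncts of all outputs other than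
    \<open>var_of l\<close>.\<close>
  have "ev (\<rho> True True) ?\<phi>" by (simp add: key)
  then have all: "sat s \<chi>"
      "\<And>x. x \<in> set xs \<Longrightarrow> if sat s (h x) then \<rho> True True (Pos x) else \<rho> True True (Neg x)"
    unfolding ev by auto
  \<comment> \<open>Exactly one of \<open>l\<close> and \<open>negate l\<close> is switched on,
    namely the one that the guard of \<open>var_of l\<close> selects.\<close>
  define w where "w \<longleftrightarrow> (sat s (h (var_of l)) \<longleftrightarrow> l = Pos (var_of l))"
  have "ev (\<rho> w (\<not> w)) ?\<phi>"
    unfolding ev
  proof (intro conjI ballI all(1))
    fix x assume x: "x \<in> set xs"
    show "if sat s (h x) then \<rho> w (\<not> w) (Pos x) else \<rho> w (\<not> w) (Neg x)"
    proof (cases "x = var_of l")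
      case True
      then show ?thesis by (cases l) (auto simp: \<rho>_def w_def)
    next
      case False
      then show ?thesis using all(2)[OF x] other[of "Pos x" w "\<not> w"] other[of "Neg x" w "\<not> w"] by simp
    qed
  qed
  then show False by (simp add: key)
qed

text \<open>Any enumeration of the output literals works, because unrealizability holds whatever set
  of output literals was made true before.\<close>

lemma SAUNF_skolem_form:
  fixes \<chi> :: "'v::countable nnf"
  assumes \<chi>: "vars \<chi> \<inter> set xs = {}" and h: "\<And>x. x \<in> set xs \<Longrightarrow> vars (h x) \<inter> set xs = {}"
    and ne: "xs \<noteq> []"
  shows "\<exists>S. SAUNF (circ (skolem_form \<chi> h xs)) (set xs) S"
proof -
  let ?\<phi> = "skolem_form \<chi> h xs" and ?e = "\<lambda>l. to_nat (Leaf l :: 'v nnf)"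
  obtain ls where ls: "set ls = Pos ` set xs \<union> Neg ` set xs" "distinct ls"
    using finite_distinct_list[of "Pos ` set xs \<union> Neg ` set xs"] by auto
  have lsv: "l \<in> set ls \<longleftrightarrow> var_of l \<in> set xs" for l
    unfolding ls by (cases l) auto
  let ?S = "map (\<lambda>l. {?e l}) ls"
  have un: "(\<Union>i<j. ?S ! i) = ?e ` ((!) ls ` {..<j})" if "j \<le> length ls" for j
    using that by auto
  have "ls \<noteq> []" using ls ne by auto
  moreover have "?S ! i \<inter> ?S ! j = {}" if "i < length ?S" "j < length ?S" "i \<noteq> j" for i j
    using that ls(2) by (auto simp: nth_eq_iff_index_eq)
  moreover have "?S ! j \<noteq> {} \<and> (\<exists>l. var_of l \<in> set xs \<and> ?S ! j \<subseteq> lit_leaves (circ ?\<phi>) l \<and>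
      \<not> and_realizable_set (relabel (circ ?\<phi>) (\<Union>i<j. ?S ! i) True) l (?S ! j))"
    if j: "j < length ?S" for j
  proof -
    let ?T = "(!) ls ` {..<j}"
    have l: "var_of (ls ! j) \<in> set xs" using j nth_mem[of j ls] by (simp flip: lsv)
    have T: "var_of ` ?T \<subseteq> set xs" unfolding image_image
    proof (intro image_subsetI)
      fix i assume "i \<in> {..<j}"
      then have "ls ! i \<in> set ls" using j by simp
      then show "var_of (ls ! i) \<in> set xs" using lsv by blast
    qed
    have leaf: "lit_leaves (circ ?\<phi>) (ls ! j) = {?e (ls ! j)}"
      by (simp add: lit_leaves_circ Leaf_in_skolem_form l)
    \<comment> \<open>The literal has a single leaf, so no other leaf of it remains to be set to
      \<open>False\<close>.\<close>
    have "lit_leaves (relabel (circ ?\<phi>) (?e ` ?T) True) (ls ! j) \<subseteq> lit_leaves (circ ?\<phi>) (ls ! j)"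
      by (auto simp: lit_leaves_def relabel_def split: if_splits)
    then have "lit_leaves (relabel (circ ?\<phi>) (?e ` ?T) True) (ls ! j) - ?S ! j = {}"
      using leaf j by auto
    moreover have "relabel G {} False = G" for G :: "(nat, 'v) circuit"
      by (simp add: relabel_def)
    ultimately have "\<not> and_realizable_set (relabel (circ ?\<phi>) (?e ` ?T) True) (ls ! j) (?S ! j)"
      unfolding and_realizable_set_def using skolem_form_unrealizable[OF \<chi> h l T] by presburger
    then show ?thesis using un[of j] j l leaf by auto
  qed
  moreover have "independent_of (sem (relabel (circ ?\<phi>) (\<Union>i<length ?S. ?S ! i) True)) (set xs)"
  proof -
    have "(!) ls ` {..<length ls} = set ls" by (auto simp: set_conv_nth)
    then have eq: "sem (relabel (circ ?\<phi>) (\<Union>i<length ?S. ?S ! i) True) =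
        (\<lambda>\<tau>. ev (\<lambda>l. l \<in> set ls \<or> lit_true \<tau> l) ?\<phi>)"
      using un[of "length ls"] sem_relabel_circ[of ?\<phi> "set ls"] by auto
    \<comment> \<open>With all output literals true, the valuation of leaves depends on the other
      variables only.\<close>
    show ?thesis
      unfolding eq independent_of_def
    proof (intro allI impI ev_cong)
      fix \<tau> \<tau>' :: "'v \<Rightarrow> bool" and l
      assume "\<forall>v. v \<notin> set xs \<longrightarrow> \<tau> v = \<tau>' v"
      then show "(l \<in> set ls \<or> lit_true \<tau> l) = (l \<in> set ls \<or> lit_true \<tau>' l)"
        using lsv[of l] by (cases l) auto
    qed
  qed
  ultimately have "SAUNF (circ ?\<phi>) (set xs) ?S" unfolding SAUNF_def by auto
  then show ?thesis by blast
qed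

section \<open>Counting gates\<close>

definition csub :: "'v nnf \<Rightarrow> 'v nnf set" where
  "csub f = sub f \<union> neg ` sub f"

text \<open>Bounds the joint size with all complements, so that negations are free.\<close>

definition buildable :: "'v nnf set \<Rightarrow> nat \<Rightarrow> bool" where
  "buildable F m \<longleftrightarrow> (\<exists>B. finite B \<and> card B \<le> m \<and> (\<forall>f\<in>F. csub f \<subseteq> B))"

lemma csub_neg [simp]: "csub (neg f) = csub f"
  by (auto simp: csub_def sub_neg image_image)

lemma csub_mk_and: "csub (mk_and f g) \<subseteq> {mk_and f g, neg (mk_and f g)} \<union> (csub f \<union> csub g)"
  by (auto simp: csub_def mk_and_def)

lemma csub_mk_or: "csub (mk_or f g) \<subseteq> {mk_or f g, neg (mk_or f g)} \<union> (csub f \<union> csub g)"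
  by (auto simp: csub_def mk_or_def)

lemma buildable_mono: "buildable F m \<Longrightarrow> F' \<subseteq> F \<Longrightarrow> m \<le> m' \<Longrightarrow> buildable F' m'"
  unfolding buildable_def by (meson order_trans subset_iff)

lemma card_sub_le_buildable: "buildable F m \<Longrightarrow> f \<in> F \<Longrightarrow> card (sub f) \<le> m"
  unfolding buildable_def csub_def by (meson card_mono le_supE order_trans)

text \<open>The elements \<open>a\<close> and \<open>b\<close> stand for a new gate and its dual:
  each gate costs 2.\<close>

lemma buildable_extend:
  assumes "buildable F m" "csub f \<subseteq> {a, b} \<union> (\<Union>g\<in>F. csub g)"
  shows "buildable (insert f F) (m + 2)"
proof -
  obtain B where B: "finite B" "card B \<le> m" "\<forall>f\<in>F. csub f \<subseteq> B"
    using assms(1) unfolding buildable_def by blast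
  have "card ({a, b} \<union> B) \<le> card {a, b} + card B" by (rule card_Un_le)
  also have "card {a, b} \<le> 2" by (simp add: card_insert_if)
  finally have "card ({a, b} \<union> B) \<le> m + 2" using B(2) by simp
  moreover have "csub f \<subseteq> {a, b} \<union> B" using assms(2) B(3) by blast
  ultimately show ?thesis using B unfolding buildable_def by (intro exI[of _ "{a, b} \<union> B"]) auto
qed

lemma buildable_empty: "buildable {} 0"
  unfolding buildable_def by (intro exI[of _ "{}"]) auto

lemma buildable_Leaf: "buildable F m \<Longrightarrow> buildable (insert (Leaf l) F) (m + 2)"
  by (rule buildable_extend[where a = "Leaf l" and b = "Leaf (negate l)"]) (auto simp: csub_def)

lemma buildable_Cst: "buildable F m \<Longrightarrow> buildable (insert (Cst c) F) (m + 2)"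
  by (rule buildable_extend[where a = "Cst c" and b = "Cst (\<not> c)"]) (auto simp: csub_def)

lemma buildable_neg: "buildable F m \<Longrightarrow> f \<in> F \<Longrightarrow> buildable (insert (neg f) F) m"
  unfolding buildable_def by auto

lemma buildable_mk_and:
  "buildable F m \<Longrightarrow> f \<in> F \<Longrightarrow> g \<in> F \<Longrightarrow> buildable (insert (mk_and f g) F) (m + 2)"
  using csub_mk_and[of f g]
  by (intro buildable_extend[where a = "mk_and f g" and b = "neg (mk_and f g)"]) blast+

lemma buildable_mk_or:
  "buildable F m \<Longrightarrow> f \<in> F \<Longrightarrow> g \<in> F \<Longrightarrow> buildable (insert (mk_or f g) F) (m + 2)"
  using csub_mk_or[of f g]
  by (intro buildable_extend[where a = "mk_or f g" and b = "neg (mk_or f g)"]) blast+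

text \<open>Three gates at cost 2 each, the complements of the arguments being free.\<close>

lemma buildable_mk_iff:
  assumes "buildable F m" "f \<in> F" "g \<in> F"
  shows "buildable (insert (mk_iff f g) F) (m + 6)"
proof -
  let ?F = "insert (neg f) (insert (neg g) F)"
  let ?G = "insert (mk_and (neg f) (neg g)) (insert (mk_and f g) ?F)"
  have "buildable ?F m" using assms by (intro buildable_neg) auto
  then have "buildable ?G (m + 2 + 2)" using assms by (intro buildable_mk_and) auto
  then have "buildable (insert (mk_iff f g) ?G) (m + 2 + 2 + 2)"
    unfolding mk_iff_def by (rule buildable_mk_or) auto
  then show ?thesis by (rule buildable_mono) auto
qed

lemma buildable_mk_xor:
  assumes "buildable F m" "f \<in> F" "g \<in> F"
  shows "buildable (insert (mk_xor f g) F) (m + 6)"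
proof -
  have "buildable (insert (mk_xor f g) (insert (neg f) F)) (m + 6)"
    using assms by (intro buildable_mk_iff buildable_neg) auto
  then show ?thesis by (rule buildable_mono) auto
qed

text \<open>The rule for a straight-line program: each step may use all earlier results and raises
  the bound by \<open>c\<close>.\<close>

lemma buildable_sequence:
  assumes "buildable F m"
    and "\<And>k s. k < M \<Longrightarrow> buildable (F \<union> f ` {..<k}) s \<Longrightarrow> buildable (insert (f k) (F \<union> f ` {..<k})) (s + c)"
  shows "buildable (F \<union> f ` {..<M}) (m + M * c)"
  using assms(2)
proof (induction M)
  case 0
  then show ?case using assms(1) by simp
next
  case (Suc M)
  then have "buildable (insert (f M) (F \<union> f ` {..<M})) (m + M * c + c)" by simp
  then show ?case by (rule buildable_mono) (auto simp: lessThan_Suc)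
qed

text \<open>The final \<open>Cst True\<close> costs 2, as does each conjunct.\<close>

lemma buildable_conjs:
  assumes "buildable F m" "set fs \<subseteq> F"
  shows "buildable (insert (conjs fs) F) (m + 2 + 2 * length fs)"
  using assms(2)
proof (induction fs)
  case Nil
  then show ?case using buildable_Cst[OF assms(1)] by simp
next
  case (Cons f fs)
  then have "buildable (insert (conjs (f # fs)) (insert (conjs fs) F)) (m + 2 + 2 * length fs + 2)"
    unfolding conjs.simps by (intro buildable_mk_and) auto
  then show ?case by (rule buildable_mono) auto
qed

section \<open>Binary addition\<close>

lemma unsigned_val_Suc: "unsigned_val (Suc m) b = unsigned_val m b + of_bool (b m) * 2 ^ m"
  by (simp add: unsigned_val_def)

lemma unsigned_val_less: "unsigned_val m b < 2 ^ m"
  by (induction m) (auto simp: unsigned_val_Suc unsigned_val_def)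

lemma unsigned_val_cong: "(\<And>i. i < m \<Longrightarrow> b i = b' i) \<Longrightarrow> unsigned_val m b = unsigned_val m b'"
  by (simp add: unsigned_val_def)

lemma unsigned_val_split:
  "j \<le> m \<Longrightarrow> unsigned_val m b = unsigned_val j b + 2 ^ j * unsigned_val (m - j) (\<lambda>i. b (j + i))"
proof (induction m rule: dec_induct)
  case base
  then show ?case by (simp add: unsigned_val_def)
next
  case (step m)
  then show ?case
    by (simp add: unsigned_val_Suc Suc_diff_le algebra_simps flip: power_add)
qed

lemma odd_unsigned_val: "m > 0 \<Longrightarrow> odd (unsigned_val m b) \<longleftrightarrow> b 0"
  using unsigned_val_split[of 1 m b] by (auto simp: unsigned_val_def)

lemma bit_unsigned_val:
  assumes "k < m"
  shows "odd (unsigned_val m b div 2 ^ k) \<longleftrightarrow> b k"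
proof -
  have "unsigned_val m b div 2 ^ k = unsigned_val (m - k) (\<lambda>i. b (k + i))"
    using unsigned_val_split[of k m b] assms unsigned_val_less[of k b] by simp
  then show ?thesis using assms by (simp add: odd_unsigned_val)
qed

lemma unsigned_val_inject:
  "unsigned_val m b = unsigned_val m b' \<longleftrightarrow> (\<forall>i<m. b i = b' i)"
  using bit_unsigned_val unsigned_val_cong by metis

text \<open>The carry into position \<open>k\<close> of a ripple-carry adder: the majority of the
  two previous bits and the previous carry.\<close>

primrec carry :: "(nat \<Rightarrow> 'v nnf) \<Rightarrow> (nat \<Rightarrow> 'v nnf) \<Rightarrow> nat \<Rightarrow> 'v nnf" where
  "carry a b 0 = Cst False"
| "carry a b (Suc k) = mk_or (mk_and (a k) (b k)) (mk_and (carry a b k) (mk_or (a k) (b k)))"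

definition add_bit :: "(nat \<Rightarrow> 'v nnf) \<Rightarrow> (nat \<Rightarrow> 'v nnf) \<Rightarrow> nat \<Rightarrow> 'v nnf" where
  "add_bit a b k = mk_xor (mk_xor (a k) (b k)) (carry a b k)"

text \<open>Keeping the outgoing carry makes the identity exact for every \<open>m\<close>, as the
  induction requires.\<close>

lemma unsigned_val_add_bit_carry:
  "unsigned_val m (\<lambda>i. sat \<tau> (add_bit a b i)) + 2 ^ m * of_bool (sat \<tau> (carry a b m)) =
   unsigned_val m (\<lambda>i. sat \<tau> (a i)) + unsigned_val m (\<lambda>i. sat \<tau> (b i))"
proof (induction m)
  case 0
  then show ?case by (simp add: unsigned_val_def)
next
  case (Suc m)
  show ?case
    unfolding unsigned_val_Suc using Suc
    by (cases "sat \<tau> (a m)"; cases "sat \<tau> (b m)"; cases "sat \<tau> (carry a b m)")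
      (auto simp: add_bit_def)
qed

lemma unsigned_val_add_bit:
  assumes "unsigned_val m (\<lambda>i. sat \<tau> (a i)) + unsigned_val m (\<lambda>i. sat \<tau> (b i)) < 2 ^ m"
  shows "unsigned_val m (\<lambda>i. sat \<tau> (add_bit a b i)) =
    unsigned_val m (\<lambda>i. sat \<tau> (a i)) + unsigned_val m (\<lambda>i. sat \<tau> (b i))"
  using unsigned_val_add_bit_carry[of m \<tau> a b] assms
  by (cases "sat \<tau> (carry a b m)") auto

lemma vars_carry: "vars (carry a b k) \<subseteq> (\<Union>i<k. vars (a i) \<union> vars (b i))"
  by (induction k) (auto simp: lessThan_Suc)

lemma vars_add_bit: "vars (add_bit a b k) \<subseteq> (\<Union>i\<le>k. vars (a i) \<union> vars (b i))"
  using vars_carry[of a b k] by (fastforce simp: add_bit_def)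

lemma reduced_add_bit:
  assumes "\<And>i. reduced (a i)" "\<And>i. reduced (b i)"
  shows "reduced (add_bit a b k)"
proof -
  have "reduced (carry a b k)" using assms by (induction k) auto
  then show ?thesis using assms by (simp add: add_bit_def)
qed

text \<open>Each position takes four carry gates (8) and two exclusive ors (12); the initial carry
  costs 2.\<close>

lemma buildable_add_bit:
  assumes F: "buildable F m" and ab: "\<And>i. i < M \<Longrightarrow> a i \<in> F" "\<And>i. i < M \<Longrightarrow> b i \<in> F"
  shows "buildable (F \<union> add_bit a b ` {..<M}) (m + 2 + M * 20)"
proof -
  \<comment> \<open>The constant carry is paid for in advance, so step \<open>k\<close> of the
    sequence produces carry \<open>Suc k\<close>.\<close>
  have "buildable (insert (carry a b 0) F \<union> (carry a b \<circ> Suc) ` {..<M}) (m + 2 + M * 8)"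
  proof (rule buildable_sequence)
    show "buildable (insert (carry a b 0) F) (m + 2)" using buildable_Cst[OF F] by simp
  next
    fix k s assume k: "k < M"
    let ?F = "insert (carry a b 0) F \<union> (carry a b \<circ> Suc) ` {..<k}"
    let ?G = "insert (mk_and (carry a b k) (mk_or (a k) (b k)))
      (insert (mk_or (a k) (b k)) (insert (mk_and (a k) (b k)) ?F))"
    assume B: "buildable ?F s"
    have "carry a b k \<in> ?F" by (cases k) auto
    then have "buildable ?G (s + 2 + 2 + 2)"
      using B ab k by (intro buildable_mk_and buildable_mk_or) auto
    then have "buildable (insert (carry a b (Suc k)) ?G) (s + 2 + 2 + 2 + 2)"
      unfolding carry.simps by (rule buildable_mk_or) auto
    then show "buildable (insert ((carry a b \<circ> Suc) k) ?F) (s + 8)"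
      by (rule buildable_mono) auto
  qed
  moreover have "carry a b k \<in> insert (carry a b 0) F \<union> (carry a b \<circ> Suc) ` {..<M}"
    if "k < M" for k
    using that by (cases k) auto
  ultimately obtain F' where F': "buildable F' (m + 2 + M * 8)" "F \<subseteq> F'"
    "\<And>k. k < M \<Longrightarrow> carry a b k \<in> F'" by blast
  have "buildable (F' \<union> add_bit a b ` {..<M}) (m + 2 + M * 8 + M * 12)"
  proof (rule buildable_sequence[OF F'(1)])
    fix k s assume k: "k < M"
    let ?F = "F' \<union> add_bit a b ` {..<k}"
    assume B: "buildable ?F s"
    have in_F: "a k \<in> ?F" "b k \<in> ?F" "carry a b k \<in> ?F"
      using ab[OF k] F'(2) F'(3)[OF k] by auto
    have "buildable (insert (mk_xor (a k) (b k)) ?F) (s + 6)"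
      by (rule buildable_mk_xor[OF B in_F(1,2)])
    then have "buildable (insert (add_bit a b k) (insert (mk_xor (a k) (b k)) ?F)) (s + 6 + 6)"
      unfolding add_bit_def[of a b k] by (rule buildable_mk_xor) (use in_F in auto)
    then show "buildable (insert (add_bit a b k) ?F) (s + 12)"
      by (rule buildable_mono) auto
  qed
  then show ?thesis by (rule buildable_mono) (use F'(2) in auto)
qed

section \<open>Exact division starting from the least significant bit\<close>

text \<open>One row of schoolbook multiplication: \<open>Y\<close> shifted by \<open>j\<close>,
  masked by \<open>q\<close>, and padded with zeros.\<close>

definition partial_product :: "nat \<Rightarrow> nat \<Rightarrow> div_var nnf \<Rightarrow> nat \<Rightarrow> div_var nnf" where
  "partial_product n j q k =
     (if j \<le> k \<and> k < j + n then mk_and q (Leaf (Pos (VY (k - j)))) else Cst False)"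

text \<open>For odd \<open>Y\<close>, adding \<open>Y\<close> shifted by \<open>j\<close> flips bit
  \<open>j\<close> of the accumulator, so it must be added exactly if that bit differs from the one
  in \<open>I\<close>.\<close>

abbreviation quot_bit :: "(nat \<Rightarrow> div_var nnf) \<Rightarrow> nat \<Rightarrow> div_var nnf" where
  "quot_bit a j \<equiv> mk_xor (a j) (Leaf (Pos (VI j)))"

text \<open>\<open>acc n j\<close> holds the bits of the product of \<open>Y\<close> with the \<open>j\<close> lowest quotient bits.\<close>

primrec acc :: "nat \<Rightarrow> nat \<Rightarrow> nat \<Rightarrow> div_var nnf" where
  "acc n 0 = (\<lambda>k. Cst False)"
| "acc n (Suc j) = add_bit (acc n j) (partial_product n j (quot_bit (acc n j) j))"

abbreviation quot :: "nat \<Rightarrow> nat \<Rightarrow> div_var nnf" where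
  "quot n j \<equiv> quot_bit (acc n j) j"

lemma unsigned_val_partial_product:
  assumes "j \<le> n"
  shows "unsigned_val (2 * n) (\<lambda>k. sat \<tau> (partial_product n j q k)) =
    of_bool (sat \<tau> q) * 2 ^ j * unsigned_val n (\<lambda>i. \<tau> (VY i))"
proof -
  \<comment> \<open>Only the positions from \<open>j\<close> to below \<open>j + n\<close>
    contribute, and \<open>j \<le> n\<close> keeps them within \<open>2 * n\<close> bits.\<close>
  have "unsigned_val (2 * n) (\<lambda>k. sat \<tau> (partial_product n j q k)) =
      (\<Sum>k = 0 + j..<n + j. of_bool (sat \<tau> q \<and> \<tau> (VY (k - j))) * 2 ^ k)"
    unfolding unsigned_val_def using assms
    by (intro sum.mono_neutral_cong_right) (auto simp: partial_product_def)
  also have "\<dots> = (\<Sum>i = 0..<n. of_bool (sat \<tau> q \<and> \<tau> (VY i)) * 2 ^ (i + j))"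
    by (subst sum.shift_bounds_nat_ivl) simp
  also have "\<dots> = of_bool (sat \<tau> q) * 2 ^ j * unsigned_val n (\<lambda>i. \<tau> (VY i))"
    by (simp add: unsigned_val_def sum_distrib_left power_add atLeast0LessThan algebra_simps of_bool_conj)
  finally show ?thesis .
qed

lemma unsigned_val_acc:
  "j \<le> n \<Longrightarrow> unsigned_val (2 * n) (\<lambda>k. sat \<tau> (acc n j k)) =
    unsigned_val j (\<lambda>i. sat \<tau> (quot n i)) * unsigned_val n (\<lambda>i. \<tau> (VY i))"
proof (induction j)
  case 0
  then show ?case by (simp add: unsigned_val_def)
next
  case (Suc j)
  let ?y = "unsigned_val n (\<lambda>i. \<tau> (VY i))" and ?q = "\<lambda>i. sat \<tau> (quot n i)"
  let ?P = "\<lambda>k. sat \<tau> (acc n j k)"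
  let ?t = "\<lambda>k. sat \<tau> (partial_product n j (quot n j) k)"
  have P: "unsigned_val (2 * n) ?P = unsigned_val j ?q * ?y"
    using Suc by simp
  have t: "unsigned_val (2 * n) ?t = of_bool (?q j) * 2 ^ j * ?y"
    using Suc.prems by (intro unsigned_val_partial_product) simp
  have eq: "unsigned_val (2 * n) ?P + unsigned_val (2 * n) ?t = unsigned_val (Suc j) ?q * ?y"
    unfolding P t unsigned_val_Suc by (simp only: distrib_right)
  \<comment> \<open>As \<open>Suc j \<le> n\<close>, the new product still fits into
    \<open>2 * n\<close> bits, so the adder does not overflow.\<close>
  also have "\<dots> < 2 ^ Suc j * 2 ^ n"
    by (intro mult_strict_mono unsigned_val_less) auto
  also have "\<dots> \<le> 2 ^ (2 * n)"
    unfolding power_add[symmetric] using Suc.prems by (intro power_increasing) auto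
  finally have "unsigned_val (2 * n) ?P + unsigned_val (2 * n) ?t < 2 ^ (2 * n)" .
  from unsigned_val_add_bit[OF this] show ?case unfolding acc.simps eq .
qed

text \<open>Multiplication by an odd number is inverted bit by bit: once the lower bits of
  \<open>x\<close> are known, bit \<open>j\<close> of the product determines
  \<open>x j\<close>.\<close>

lemma quot_of_product:
  assumes odd: "odd (unsigned_val n (\<lambda>i. \<tau> (VY i)))"
    and prod: "unsigned_val n x * unsigned_val n (\<lambda>i. \<tau> (VY i)) = unsigned_val (2 * n) (\<lambda>i. \<tau> (VI i))"
  shows "j < n \<Longrightarrow> sat \<tau> (quot n j) = x j"
proof (induction j rule: less_induct)
  case (less j)
  let ?y = "unsigned_val n (\<lambda>i. \<tau> (VY i))"
  have low: "unsigned_val j (\<lambda>i. sat \<tau> (quot n i)) = unsigned_val j x"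
    using less by (intro unsigned_val_cong) auto
  let ?r = "unsigned_val (n - j) (\<lambda>i. x (j + i))"
  \<comment> \<open>Split \<open>x\<close> at bit \<open>j\<close>: by induction the low part times
    \<open>?y\<close> is the accumulator, and the high part contributes a multiple of
    \<open>2 ^ j\<close>.\<close>
  have "unsigned_val (2 * n) (\<lambda>i. \<tau> (VI i)) = (unsigned_val j x + 2 ^ j * ?r) * ?y"
    using prod unsigned_val_split[of j n x] less.prems by simp
  also have "\<dots> = unsigned_val (2 * n) (\<lambda>k. sat \<tau> (acc n j k)) + 2 ^ j * (?r * ?y)"
    using unsigned_val_acc[of j n \<tau>] less.prems low by (simp add: algebra_simps)
  finally have "unsigned_val (2 * n) (\<lambda>i. \<tau> (VI i)) div 2 ^ j =
      unsigned_val (2 * n) (\<lambda>k. sat \<tau> (acc n j k)) div 2 ^ j + ?r * ?y" by simp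
  then have "odd (unsigned_val (2 * n) (\<lambda>i. \<tau> (VI i)) div 2 ^ j) \<longleftrightarrow>
      odd (unsigned_val (2 * n) (\<lambda>k. sat \<tau> (acc n j k)) div 2 ^ j) \<noteq> odd (?r * ?y)"
    by (simp only: odd_add)
  \<comment> \<open>Since \<open>?y\<close> is odd, \<open>?r * ?y\<close> has the parity of
    \<open>?r\<close>, which is the bit \<open>x j\<close>.\<close>
  then have "\<tau> (VI j) \<longleftrightarrow> sat \<tau> (acc n j j) \<noteq> x j"
    using less.prems odd by (simp add: bit_unsigned_val odd_unsigned_val)
  then show ?case by auto
qed

text \<open>The full product is formed with the computed quotient in place of \<open>X\<close>, so
  this is a condition on the inputs. The two lowest bits express oddness.\<close>

definition exactness :: "nat \<Rightarrow> div_var nnf" where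
  "exactness n = conjs (Leaf (Pos (VI 0)) # Leaf (Pos (VY 0)) #
     map (\<lambda>k. mk_iff (acc n n k) (Leaf (Pos (VI k)))) [0..<2 * n])"

definition div_form :: "nat \<Rightarrow> div_var nnf" where
  "div_form n = skolem_form (exactness n) (\<lambda>v. case v of VX j \<Rightarrow> quot n j | _ \<Rightarrow> Cst False)
     (map VX [0..<n])"

lemma sat_div_form:
  assumes "n \<ge> 1"
  shows "sat \<tau> (div_form n) = odd_division_spec n \<tau>"
proof -
  let ?x = "\<lambda>i. \<tau> (VX i)" and ?q = "\<lambda>i. sat \<tau> (quot n i)"
  let ?y = "unsigned_val n (\<lambda>i. \<tau> (VY i))" and ?z = "unsigned_val (2 * n) (\<lambda>i. \<tau> (VI i))"
  have "sat \<tau> (div_form n) \<longleftrightarrow> \<tau> (VI 0) \<and> \<tau> (VY 0) \<and> (\<forall>k<2 * n. sat \<tau> (acc n n k) = \<tau> (VI k)) \<and>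
      (\<forall>j<n. ?x j = ?q j)"
    unfolding div_form_def ev_skolem_form by (auto simp: exactness_def)
  \<comment> \<open>Agreement in all \<open>2 * n\<close> bits is equality of values, and the value
    of \<open>acc n n\<close> is the product of \<open>?q\<close> and \<open>?y\<close>.\<close>
  also have "\<dots> \<longleftrightarrow> odd ?z \<and> odd ?y \<and> unsigned_val n ?q * ?y = ?z \<and> (\<forall>j<n. ?x j = ?q j)"
    using assms unsigned_val_acc[of n n \<tau>]
      unsigned_val_inject[of "2 * n" "\<lambda>k. sat \<tau> (acc n n k)" "\<lambda>i. \<tau> (VI i)"]
    by (simp add: odd_unsigned_val)
  also have "\<dots> \<longleftrightarrow> odd ?z \<and> odd ?y \<and> unsigned_val n ?x * ?y = ?z"
  proof (safe)
    assume "unsigned_val n ?q * ?y = ?z" "\<forall>j<n. ?x j = ?q j"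
    then show "unsigned_val n ?x * ?y = ?z" using unsigned_val_cong[of n ?x ?q] by simp
  next
    \<comment> \<open>Conversely, a quotient \<open>?x\<close> forces the computed bits to coincide
      with it, so they divide exactly too.\<close>
    assume *: "odd ?y" "unsigned_val n ?x * ?y = ?z"
    then have q: "?q j = ?x j" if "j < n" for j using quot_of_product that by blast
    show "unsigned_val n ?q * ?y = ?z" using unsigned_val_cong[of n ?q ?x] q *(2) by simp
    show "?q j" if "j < n" "?x j" for j using q that by blast
    show "?x j" if "j < n" "?q j" for j using q that by blast
  qed
  finally show ?thesis by (simp add: odd_division_spec_def Let_def)
qed

section \<open>Variables and reducedness of the division formula\<close>

lemma vars_acc: "j \<le> n \<Longrightarrow> k < 2 * n \<Longrightarrow> vars (acc n j k) \<subseteq> VI ` {..<2 * n} \<union> VY ` {..<n}"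
proof (induction j arbitrary: k)
  case (Suc j)
  \<comment> \<open>The quotient bit enters the partial product, so the induction hypothesis is used
    at position \<open>j\<close> as well as at \<open>i\<close>.\<close>
  have "vars (acc n j i) \<union> vars (partial_product n j (quot n j) i) \<subseteq> VI ` {..<2 * n} \<union> VY ` {..<n}"
    if "i \<le> k" for i
    using that Suc.IH[of i] Suc.IH[of j] Suc.prems
    by (auto simp: partial_product_def)
  then show ?case unfolding acc.simps by (intro order_trans[OF vars_add_bit] UN_least) simp
qed auto

lemma vars_quot: "j < n \<Longrightarrow> vars (quot n j) \<subseteq> VI ` {..<2 * n} \<union> VY ` {..<n}"
  using vars_acc[of j n j] by auto

lemma vars_exactness: "n \<ge> 1 \<Longrightarrow> vars (exactness n) \<subseteq> VI ` {..<2 * n} \<union> VY ` {..<n}"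
  using vars_acc[of n n] by (fastforce simp: exactness_def)

lemma vars_div_form:
  assumes "n \<ge> 1"
  shows "vars (div_form n) \<subseteq> VX ` {..<n} \<union> VI ` {..<2 * n} \<union> VY ` {..<n}"
proof -
  have "vars (mk_iff (Leaf (Pos (VX j))) (quot n j)) \<subseteq> VX ` {..<n} \<union> VI ` {..<2 * n} \<union> VY ` {..<n}"
    if "j < n" for j
    using vars_quot[OF that] that by auto
  then have "(\<Union>j<n. vars (mk_iff (Leaf (Pos (VX j))) (quot n j)))
      \<subseteq> VX ` {..<n} \<union> VI ` {..<2 * n} \<union> VY ` {..<n}" by (intro UN_least) simp
  moreover have "vars (div_form n) = vars (exactness n) \<union> (\<Union>j<n. vars (mk_iff (Leaf (Pos (VX j))) (quot n j)))"
    by (simp add: div_form_def skolem_form_def atLeast0LessThan image_image del: vars_mk(3))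
  moreover have "vars (exactness n) \<subseteq> VX ` {..<n} \<union> VI ` {..<2 * n} \<union> VY ` {..<n}"
    by (rule order_trans[OF vars_exactness[OF assms]]) auto
  ultimately show ?thesis by simp
qed

lemma reduced_acc: "reduced (acc n j k)"
proof (induction j arbitrary: k)
  case (Suc j)
  then show ?case unfolding acc.simps
    by (intro reduced_add_bit) (auto simp: partial_product_def)
qed simp

lemma reduced_div_form: "reduced (div_form n)"
  unfolding div_form_def skolem_form_def exactness_def
  by (intro reduced_mk reduced_conjs) (auto simp: reduced_acc)

section \<open>The quadratic size bound\<close>

definition inputs :: "nat \<Rightarrow> div_var nnf set" where
  "inputs n = insert (Cst False) ((\<lambda>v. Leaf (Pos v)) ` (VX ` {..<n} \<union> VI ` {..<2 * n} \<union> VY ` {..<n}))"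

lemma buildable_Leaf_image:
  "buildable F m \<Longrightarrow> buildable (F \<union> (\<lambda>i. Leaf (f i)) ` {..<M}) (m + M * 2)"
  by (rule buildable_sequence) (simp_all only: buildable_Leaf)

text \<open>One constant and \<open>4 * n\<close> variables, each counted with its complement. The
  constant also provides the zero padding and the initial accumulator.\<close>

lemma buildable_inputs: "buildable (inputs n) (2 + 8 * n)"
proof -
  have "buildable (insert (Cst False) {} \<union> (\<lambda>i. Leaf (Pos (VX i))) ` {..<n}
      \<union> (\<lambda>i. Leaf (Pos (VI i))) ` {..<2 * n} \<union> (\<lambda>i. Leaf (Pos (VY i))) ` {..<n})
      (0 + 2 + n * 2 + (2 * n) * 2 + n * 2)"
    by (intro buildable_Leaf_image buildable_Cst buildable_empty)
  then show ?thesis by (rule buildable_mono) (auto simp: inputs_def)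
qed

text \<open>A stage costs 6 for the quotient bit, \<open>4 * n\<close> for the partial product, and
  \<open>2 + 40 * n\<close> for the addition. Quotient bits are kept for later use as Skolem
  functions.\<close>

lemma buildable_acc:
  "j \<le> n \<Longrightarrow> buildable (inputs n \<union> quot n ` {..<j} \<union> acc n j ` {..<2 * n}) (2 + 8 * n + j * (8 + 44 * n))"
proof (induction j)
  case 0
  have "inputs n \<union> quot n ` {..<0} \<union> acc n 0 ` {..<2 * n} \<subseteq> inputs n" by (auto simp: inputs_def)
  then show ?case using buildable_mono[OF buildable_inputs _ order_refl] by simp
next
  case (Suc j)
  let ?F = "inputs n \<union> quot n ` {..<j} \<union> acc n j ` {..<2 * n}"
  let ?m = "2 + 8 * n + j * (8 + 44 * n)"
  let ?t = "partial_product n j (quot n j)"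
  have "buildable ?F ?m" using Suc by simp
  then have "buildable (insert (quot n j) ?F) (?m + 6)"
    using Suc.prems by (intro buildable_mk_xor) (auto simp: inputs_def)
  then have "buildable (insert (quot n j) ?F \<union> ?t ` {..<2 * n}) (?m + 6 + (2 * n) * 2)"
  proof (rule buildable_sequence)
    fix k s
    let ?G = "insert (quot n j) ?F \<union> ?t ` {..<k}"
    assume B: "buildable ?G s"
    show "buildable (insert (?t k) ?G) (s + 2)"
    proof (cases "j \<le> k \<and> k < j + n")
      case True
      then have "k - j < n" by auto
      then have "Leaf (Pos (VY (k - j))) \<in> ?G" by (auto simp: inputs_def)
      then have "buildable (insert (mk_and (quot n j) (Leaf (Pos (VY (k - j))))) ?G) (s + 2)"
        using B by (intro buildable_mk_and) auto
      moreover have "?t k = mk_and (quot n j) (Leaf (Pos (VY (k - j))))"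
        using True by (simp add: partial_product_def)
      ultimately show ?thesis by simp
    next
      case False
      then have "?t k = Cst False" by (auto simp: partial_product_def)
      then show ?thesis using buildable_Cst[OF B] by simp
    qed
  qed
  then have "buildable (insert (quot n j) ?F \<union> ?t ` {..<2 * n} \<union> add_bit (acc n j) ?t ` {..<2 * n})
      (?m + 6 + (2 * n) * 2 + 2 + (2 * n) * 20)"
    by (rule buildable_add_bit) auto
  then show ?case
    by (rule buildable_mono) (auto simp: lessThan_Suc algebra_simps)
qed

lemma card_sub_div_form: "card (sub (div_form n)) \<le> 44 * n * n + 40 * n + 16"
proof -
  let ?F = "inputs n \<union> quot n ` {..<n} \<union> acc n n ` {..<2 * n}"
  let ?m = "2 + 8 * n + n * (8 + 44 * n)"
  let ?e = "\<lambda>k. mk_iff (acc n n k) (Leaf (Pos (VI k)))"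
  let ?s = "\<lambda>j. mk_iff (Leaf (Pos (VX j))) (quot n j)"
  let ?i = "insert (Leaf (Pos (VY 0))) (insert (Leaf (Pos (VI 0))) ?F)"
  have "buildable ?i (?m + 2 + 2)"
    by (intro buildable_Leaf buildable_acc) simp
  then have "buildable (?i \<union> ?e ` {..<2 * n}) (?m + 2 + 2 + (2 * n) * 6)"
    by (rule buildable_sequence) (intro buildable_mk_iff, auto simp: inputs_def)
  then have "buildable (?i \<union> ?e ` {..<2 * n} \<union> ?s ` {..<n}) (?m + 2 + 2 + (2 * n) * 6 + n * 6)"
    by (rule buildable_sequence) (intro buildable_mk_iff, auto simp: inputs_def)
  from buildable_conjs[OF this, of "Leaf (Pos (VI 0)) # Leaf (Pos (VY 0)) # map ?e [0..<2 * n]"]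
  have "buildable (insert (exactness n) (?i \<union> ?e ` {..<2 * n} \<union> ?s ` {..<n}))
      (?m + 2 + 2 + (2 * n) * 6 + n * 6 + 2 + 2 * (2 * n + 2))"
    by (fastforce simp: exactness_def algebra_simps)
  from buildable_conjs[OF this, of "map ?s [0..<n]"]
  have "buildable (insert (conjs (map ?s [0..<n]))
        (insert (exactness n) (?i \<union> ?e ` {..<2 * n} \<union> ?s ` {..<n})))
      (?m + 2 + 2 + (2 * n) * 6 + n * 6 + 2 + 2 * (2 * n + 2) + 2 + 2 * n)"
    by fastforce
  \<comment> \<open>The accumulated costs sum to exactly the stated quadratic.\<close>
  from buildable_mk_and[OF this, of "exactness n" "conjs (map ?s [0..<n])"]
  have "buildable {mk_and (exactness n) (conjs (map ?s [0..<n]))} (44 * n * n + 40 * n + 16)"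
    by (rule buildable_mono[OF _ _ eq_imp_le]) (auto simp: algebra_simps)
  moreover have "div_form n = mk_and (exactness n) (conjs (map ?s [0..<n]))"
    by (simp add: div_form_def skolem_form_def comp_def)
  ultimately show ?thesis using card_sub_le_buildable by fastforce
qed

theorem theorem7:
  shows "\<exists>p :: nat poly. \<forall>n :: nat. n \<ge> 1 \<longrightarrow>
    (\<exists>(G :: (nat, div_var) circuit) (S :: nat set list).
       nnf_circuit G \<and>
       circuit_vars G \<subseteq> VX ` {..<n} \<union> VI ` {..<2 * n} \<union> VY ` {..<n} \<and>
       sem G = odd_division_spec n \<and>
       circuit_size G \<le> poly p n \<and>
       SAUNF G (VX ` {..<n}) S)"
\<comment> \<open>The coefficients are those of \<open>card_sub_div_form\<close>, lowest degree
  first.\<close>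
proof (intro exI[of _ "[:16, 40, 44:]"] allI impI)
  fix n :: nat assume n: "n \<ge> 1"
  let ?h = "\<lambda>v. case v of VX j \<Rightarrow> quot n j | _ \<Rightarrow> Cst False"
  have "\<exists>S. SAUNF (circ (div_form n)) (set (map VX [0..<n])) S"
    unfolding div_form_def
  proof (rule SAUNF_skolem_form)
    show "vars (exactness n) \<inter> set (map VX [0..<n]) = {}"
      using vars_exactness[OF n] by fastforce
    show "vars (?h x) \<inter> set (map VX [0..<n]) = {}" if "x \<in> set (map VX [0..<n])" for x
      using that vars_quot[of _ n] by fastforce
    show "map VX [0..<n] \<noteq> []" using n by simp
  qed
  then obtain S where "SAUNF (circ (div_form n)) (VX ` {..<n}) S"
    by (auto simp: atLeast0LessThan)
  moreover have "sem (circ (div_form n)) = odd_division_spec n"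
    using sat_div_form[OF n] by (auto simp: sem_circ)
  moreover have "circuit_size (circ (div_form n)) \<le> poly [:16, 40, 44:] n"
    using card_sub_div_form[of n] by (simp add: circuit_size_circ algebra_simps)
  moreover have "circuit_vars (circ (div_form n)) \<subseteq> VX ` {..<n} \<union> VI ` {..<2 * n} \<union> VY ` {..<n}"
    using circuit_vars_circ vars_div_form[OF n] by blast
  ultimately show "\<exists>(G :: (nat, div_var) circuit) (S :: nat set list).
       nnf_circuit G \<and>
       circuit_vars G \<subseteq> VX ` {..<n} \<union> VI ` {..<2 * n} \<union> VY ` {..<n} \<and>
       sem G = odd_division_spec n \<and>
       circuit_size G \<le> poly [:16, 40, 44:] n \<and>
       SAUNF G (VX ` {..<n}) S"
    using nnf_circuit_circ[OF reduced_div_form] by blast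
qed

end
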